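(* Let $\mathcal{T}$ be an a.d.f.s. family and let $G$ be a $\mathbb{T}(\mathcal{T})$-generic filter. Then in $V[G]$ the family $\mathcal{S}_G$ diagonalizes $\mathcal{T}$.
   Context: Trees: a tree is a nonempty $T\subseteq\omega^{<\omega}$ closed under initial segments; it is finitely splitting if every $s\in T$ has at least one and only finitely many immediate successors in $T$. $[T]=\{f\in\omega^\omega\mid \forall n\ f\restriction n\in T\}$. For $n<\omega$, a finitely splitting $n$-tree is a nonempty $T\subseteq\omega^{\le n}$ closed under initial segments such that every $s\in T$ of length $<n$ has at least one and only finitely many immediate successors in $T$. An a.d.f.s. family is a set $\mathcal{T}$ of finitely splitting trees such that $S\cap T$ is finite for all distinct $S,T\in\mathcal{T}$. For an a.d.f.s. family $\mathcal{T}$ let $\mathcal{W}(\mathcal{T})=\{f\in\omega^\omega\mid f\notin[T]\text{ for all }T\in\mathcal{T}\}$ and $\mathcal{I}^+(\mathcal{T})=\{T\mid T\text{ is a finitely splitting tree with }[T]\subseteq\mathcal{W}(\mathcal{T})\}$. Diagonalization: for an a.d.f.s. family $\mathcal{T}\in V$ and a generic extension $V[G]$, a set $\mathcal{S}\in V[G]$ of finitely splitting trees diagonalizes $\mathcal{T}$ iff (in $V[G]$) $\mathcal{T}\cup\mathcal{S}$ is an a.d.f.s. family and for every $T\in\mathcal{I}^+(\mathcal{T})^V$ there is $S\in\mathcal{S}$ such that $S\cap T$ is infinite. $\mathbb{T}$ is the set of partial functions $p:\omega\times\omega^{<\omega}\to 2$ such that $\operatorname{dom}(p)=F_p\times\omega^{\le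 n_p}$ with $n_p\in\omega$, $F_p\subseteq\omega$ finite, and for all $i\in F_p$ the set $T^i_p=\{s\in\omega^{\le n_p}\mid p(i)(s)=1\}$ is a finitely splitting $n_p$-tree (here $p(i)(s)=p(i,s)$). Order: $p\le q$ iff $p\supseteq q$. $\mathbb{T}(\mathcal{T})$ is the set of pairs $(p,w_p)$ with $p\in\mathbb{T}$ and $w_p$ a function from a finite set $H_p\subseteq\mathcal{W}(\mathcal{T})$ to $\omega$ such that for all $f\in H_p$: $w_p(f)\notin F_p$ or $f\restriction n_p\in T_p^{w_p(f)}$. Order: $(p,w_p)\le(q,w_q)$ iff $p\supseteq q$ and $w_p\supseteq w_q$. For a $\mathbb{T}(\mathcal{T})$-generic filter $G$, $\mathcal{S}_G=\{S_{G,i}\mid i\in\omega\}$ where $S_{G,i}=\{s\in\omega^{<\omega}\mid \exists (p,w_p)\in G\ \ p(i)(s)=1\}$. *)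

theory Defs
  imports Main "HOL-Library.Sublist"
begin

section \<open>Almost disjoint families of finitely splitting trees\<close>

text \<open>Elements of \<open>\<omega>\<^sup><\<^sup>\<omega>\<close> are lists of naturals; initial segments are prefixes.\<close>

definition imm_succ :: "nat list \<Rightarrow> nat list \<Rightarrow> bool" where
  "imm_succ s t \<longleftrightarrow> (\<exists>k. t = s @ [k])"

definition fs_tree :: "nat list set \<Rightarrow> bool" where
  "fs_tree T \<longleftrightarrow> T \<noteq> {} \<and> (\<forall>s t. prefix s t \<and> t \<in> T \<longrightarrow> s \<in> T) \<and>
     (\<forall>s\<in>T. (\<exists>t. imm_succ s t \<and> t \<in> T) \<and> finite {t. imm_succ s t \<and> t \<in> T})"

definition fs_ntree :: "nat \<Rightarrow> nat list set \<Rightarrow> bool" where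
  "fs_ntree n T \<longleftrightarrow> T \<noteq> {} \<and> T \<subseteq> {s. length s \<le> n} \<and>
     (\<forall>s t. prefix s t \<and> t \<in> T \<longrightarrow> s \<in> T) \<and>
     (\<forall>s\<in>T. length s < n \<longrightarrow>
        (\<exists>t. imm_succ s t \<and> t \<in> T) \<and> finite {t. imm_succ s t \<and> t \<in> T})"

definition restr :: "(nat \<Rightarrow> nat) \<Rightarrow> nat \<Rightarrow> nat list" where
  "restr f n = map f [0..<n]"

definition branches :: "nat list set \<Rightarrow> (nat \<Rightarrow> nat) set" where
  "branches T = {f. \<forall>n. restr f n \<in> T}"

definition adfs :: "nat list set set \<Rightarrow> bool" where
  "adfs \<T> \<longleftrightarrow> (\<forall>T\<in>\<T>. fs_tree T) \<and> (\<forall>S\<in>\<T>. \<forall>T\<in>\<T>. S \<noteq> T \<longrightarrow> finite (S \<inter> T))"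

definition W :: "nat list set set \<Rightarrow> (nat \<Rightarrow> nat) set" where
  "W \<T> = {f. \<forall>T\<in>\<T>. f \<notin> branches T}"

definition I_plus :: "nat list set set \<Rightarrow> nat list set set" where
  "I_plus \<T> = {T. fs_tree T \<and> branches T \<subseteq> W \<T>}"

section \<open>The forcing notion\<close>

text \<open>The value \<open>1\<close> of a partial function into \<open>2\<close> is rendered as \<open>True\<close>.\<close>

type_synonym tcond = "nat \<times> nat list \<rightharpoonup> bool"
type_synonym cond = "tcond \<times> ((nat \<Rightarrow> nat) \<rightharpoonup> nat)"

definition level_tree :: "tcond \<Rightarrow> nat \<Rightarrow> nat list set" where
  "level_tree p i = {s. p (i, s) = Some True}"

text \<open>\<open>tree_cond F n p\<close>: \<open>p\<close> is a condition with \<open>F\<^sub>p = F\<close> and \<open>n\<^sub>p = n\<close>. For \<open>F = {}\<close> the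
  number \<open>n\<close> is not determined by \<open>p\<close>, but then it is irrelevant in \<open>TT\<close> below as well.\<close>

definition tree_cond :: "nat set \<Rightarrow> nat \<Rightarrow> tcond \<Rightarrow> bool" where
  "tree_cond F n p \<longleftrightarrow> finite F \<and> dom p = F \<times> {s. length s \<le> n} \<and>
     (\<forall>i\<in>F. fs_ntree n (level_tree p i))"

definition TT :: "nat list set set \<Rightarrow> cond set" where
  "TT \<T> = {(p, w). \<exists>F n. tree_cond F n p \<and> finite (dom w) \<and> dom w \<subseteq> W \<T> \<and>
     (\<forall>f i. w f = Some i \<longrightarrow> i \<notin> F \<or> restr f n \<in> level_tree p i)}"

definition TT_le :: "cond \<Rightarrow> cond \<Rightarrow> bool" where
  "TT_le c d \<longleftrightarrow> fst d \<subseteq>\<^sub>m fst c \<and> snd d \<subseteq>\<^sub>m snd c"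

section \<open>Names and the forcing relation\<close>

text \<open>
  The ground model \<open>V\<close> is the ambient universe, and statements about \<open>V[G]\<close> for generic \<open>G\<close> are
  interpreted through the forcing relation: \<open>\<phi>\<close> holds in \<open>V[G]\<close> for every generic \<open>G\<close> iff every
  condition forces \<open>\<phi>\<close>. (Quantifying over actual filters that meet all dense sets would be void,
  since for an atomless forcing no such filter exists in the ground model.)

  A name of type \<open>('a, 'c) name\<close> names a subset of the ground model set \<open>'a\<close>. Every subset of
  \<open>'a\<close> in \<open>V[G]\<close> has such a name, and every family of such subsets in \<open>V[G]\<close> has a name of type
  \<open>(('a, 'c) name, 'c) name\<close>. So quantification over these names is quantification over all
  subsets, respectively families of subsets, that exist in \<open>V[G]\<close>.
\<close>

type_synonym ('a, 'c) name = "('a \<times> 'c) set"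

definition val :: "'c set \<Rightarrow> ('a, 'c) name \<Rightarrow> 'a set" where
  "val G \<sigma> = {x. \<exists>r\<in>G. (x, r) \<in> \<sigma>}"

definition val_fam :: "'c set \<Rightarrow> (('a, 'c) name, 'c) name \<Rightarrow> 'a set set" where
  "val_fam G \<Sigma> = val G ` val G \<Sigma>"

definition check :: "'c set \<Rightarrow> 'a set \<Rightarrow> ('a, 'c) name" where
  "check P A = A \<times> P"

definition check_fam :: "'c set \<Rightarrow> 'a set set \<Rightarrow> (('a, 'c) name, 'c) name" where
  "check_fam P \<A> = check P (check P ` \<A>)"

definition dense_below :: "'c set \<Rightarrow> ('c \<Rightarrow> 'c \<Rightarrow> bool) \<Rightarrow> 'c \<Rightarrow> ('c \<Rightarrow> bool) \<Rightarrow> bool" where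
  "dense_below P le p D \<longleftrightarrow> (\<forall>q\<in>P. le q p \<longrightarrow> (\<exists>r\<in>P. le r q \<and> D r))"

definition forces_mem :: "'c set \<Rightarrow> ('c \<Rightarrow> 'c \<Rightarrow> bool) \<Rightarrow> 'a \<Rightarrow> ('a, 'c) name \<Rightarrow> 'c \<Rightarrow> bool" where
  "forces_mem P le x \<sigma> p \<longleftrightarrow> dense_below P le p (\<lambda>q. \<exists>r\<in>P. (x, r) \<in> \<sigma> \<and> le q r)"

definition forces_eq ::
    "'c set \<Rightarrow> ('c \<Rightarrow> 'c \<Rightarrow> bool) \<Rightarrow> ('a, 'c) name \<Rightarrow> ('a, 'c) name \<Rightarrow> 'c \<Rightarrow> bool" where
  "forces_eq P le \<sigma> \<tau> p \<longleftrightarrow>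
     (\<forall>x. \<forall>q\<in>P. le q p \<longrightarrow> (forces_mem P le x \<sigma> q \<longleftrightarrow> forces_mem P le x \<tau> q))"

definition forces_mem_fam ::
    "'c set \<Rightarrow> ('c \<Rightarrow> 'c \<Rightarrow> bool) \<Rightarrow> ('a, 'c) name \<Rightarrow> (('a, 'c) name, 'c) name \<Rightarrow> 'c \<Rightarrow> bool" where
  "forces_mem_fam P le \<sigma> \<Sigma> p \<longleftrightarrow>
     dense_below P le p (\<lambda>q. \<exists>\<tau>. \<exists>r\<in>P. (\<tau>, r) \<in> \<Sigma> \<and> le q r \<and> forces_eq P le \<sigma> \<tau> q)"

text \<open>
  Sentences of the forcing language. \<open>Ground b\<close> is an absolute assertion about ground model
  parameters. The individual quantifiers range over \<open>\<omega>\<close> and \<open>\<omega>\<^sup><\<^sup>\<omega>\<close> (which are the same in \<open>V\<close> and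
  \<open>V[G]\<close>), the set quantifiers over all subsets of \<open>\<omega>\<^sup><\<^sup>\<omega>\<close> and of \<open>\<omega> \<times> \<omega>\<^sup><\<^sup>\<omega>\<close> in \<open>V[G]\<close>.
\<close>

datatype 'c fm =
    Ground bool
  | SeqIn "nat list" "(nat list, 'c) name"
  | PairIn "nat \<times> nat list" "(nat \<times> nat list, 'c) name"
  | SetIn "(nat list, 'c) name" "((nat list, 'c) name, 'c) name"
  | Neg "'c fm"
  | And "'c fm" "'c fm"
  | AllNat "nat \<Rightarrow> 'c fm"
  | AllSeq "nat list \<Rightarrow> 'c fm"
  | AllSet "(nat list, 'c) name \<Rightarrow> 'c fm"
  | AllRel "(nat \<times> nat list, 'c) name \<Rightarrow> 'c fm"

primrec forces :: "'c set \<Rightarrow> ('c \<Rightarrow> 'c \<Rightarrow> bool) \<Rightarrow> 'c fm \<Rightarrow> 'c \<Rightarrow> bool" where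
  "forces P le (Ground b) = (\<lambda>p. b)"
| "forces P le (SeqIn s \<sigma>) = forces_mem P le s \<sigma>"
| "forces P le (PairIn x \<rho>) = forces_mem P le x \<rho>"
| "forces P le (SetIn \<sigma> \<Sigma>) = forces_mem_fam P le \<sigma> \<Sigma>"
| "forces P le (Neg \<phi>) = (\<lambda>p. \<forall>q\<in>P. le q p \<longrightarrow> \<not> forces P le \<phi> q)"
| "forces P le (And \<phi> \<psi>) = (\<lambda>p. forces P le \<phi> p \<and> forces P le \<psi> p)"
| "forces P le (AllNat \<Phi>) = (\<lambda>p. \<forall>n. forces P le (\<Phi> n) p)"
| "forces P le (AllSeq \<Phi>) = (\<lambda>p. \<forall>s. forces P le (\<Phi> s) p)"
| "forces P le (AllSet \<Phi>) = (\<lambda>p. \<forall>\<sigma>. forces P le (\<Phi> \<sigma>) p)"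
| "forces P le (AllRel \<Phi>) = (\<lambda>p. \<forall>\<rho>. forces P le (\<Phi> \<rho>) p)"

definition holds_in_extension :: "'c set \<Rightarrow> ('c \<Rightarrow> 'c \<Rightarrow> bool) \<Rightarrow> 'c fm \<Rightarrow> bool" where
  "holds_in_extension P le \<phi> \<longleftrightarrow> (\<forall>p\<in>P. forces P le \<phi> p)"

definition Imp :: "'c fm \<Rightarrow> 'c fm \<Rightarrow> 'c fm" where
  "Imp \<phi> \<psi> = Neg (And \<phi> (Neg \<psi>))"
definition Iff :: "'c fm \<Rightarrow> 'c fm \<Rightarrow> 'c fm" where
  "Iff \<phi> \<psi> = And (Imp \<phi> \<psi>) (Imp \<psi> \<phi>)"
definition ExNat :: "(nat \<Rightarrow> 'c fm) \<Rightarrow> 'c fm" where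
  "ExNat \<Phi> = Neg (AllNat (\<lambda>n. Neg (\<Phi> n)))"
definition ExSeq :: "(nat list \<Rightarrow> 'c fm) \<Rightarrow> 'c fm" where
  "ExSeq \<Phi> = Neg (AllSeq (\<lambda>s. Neg (\<Phi> s)))"
definition ExSet :: "((nat list, 'c) name \<Rightarrow> 'c fm) \<Rightarrow> 'c fm" where
  "ExSet \<Phi> = Neg (AllSet (\<lambda>\<sigma>. Neg (\<Phi> \<sigma>)))"
definition ExRel :: "((nat \<times> nat list, 'c) name \<Rightarrow> 'c fm) \<Rightarrow> 'c fm" where
  "ExRel \<Phi> = Neg (AllRel (\<lambda>\<rho>. Neg (\<Phi> \<rho>)))"

section \<open>The notions about trees, spoken of inside the extension\<close>

definition EqSet :: "(nat list, 'c) name \<Rightarrow> (nat list, 'c) name \<Rightarrow> 'c fm" where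
  "EqSet \<sigma> \<tau> = AllSeq (\<lambda>s. Iff (SeqIn s \<sigma>) (SeqIn s \<tau>))"

text \<open>\<open>\<rho>\<close> is a bijection from \<open>n = {0,\<dots>,n-1}\<close> onto the class of all \<open>s\<close> with \<open>\<Phi> s\<close>.\<close>

definition Bij_fm :: "nat \<Rightarrow> (nat list \<Rightarrow> 'c fm) \<Rightarrow> (nat \<times> nat list, 'c) name \<Rightarrow> 'c fm" where
  "Bij_fm n \<Phi> \<rho> =
     And (AllNat (\<lambda>k. AllSeq (\<lambda>s. Imp (PairIn (k, s) \<rho>) (And (Ground (k < n)) (\<Phi> s)))))
    (And (AllNat (\<lambda>k. Imp (Ground (k < n)) (ExSeq (\<lambda>s. PairIn (k, s) \<rho>))))
    (And (AllNat (\<lambda>k. AllSeq (\<lambda>s. AllSeq (\<lambda>t.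
            Imp (And (PairIn (k, s) \<rho>) (PairIn (k, t) \<rho>)) (Ground (s = t))))))
    (And (AllSeq (\<lambda>s. Imp (\<Phi> s) (ExNat (\<lambda>k. PairIn (k, s) \<rho>))))
         (AllSeq (\<lambda>s. AllNat (\<lambda>k. AllNat (\<lambda>l.
            Imp (And (PairIn (k, s) \<rho>) (PairIn (l, s) \<rho>)) (Ground (k = l)))))))))"

definition Finite_fm :: "(nat list \<Rightarrow> 'c fm) \<Rightarrow> 'c fm" where
  "Finite_fm \<Phi> = ExNat (\<lambda>n. ExRel (\<lambda>\<rho>. Bij_fm n \<Phi> \<rho>))"

definition Finite_inter :: "(nat list, 'c) name \<Rightarrow> (nat list, 'c) name \<Rightarrow> 'c fm" where
  "Finite_inter \<sigma> \<tau> = Finite_fm (\<lambda>s. And (SeqIn s \<sigma>) (SeqIn s \<tau>))"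

definition FsTree_fm :: "(nat list, 'c) name \<Rightarrow> 'c fm" where
  "FsTree_fm \<sigma> =
     And (ExSeq (\<lambda>s. SeqIn s \<sigma>))
    (And (AllSeq (\<lambda>s. AllSeq (\<lambda>t. Imp (And (Ground (prefix s t)) (SeqIn t \<sigma>)) (SeqIn s \<sigma>))))
         (AllSeq (\<lambda>s. Imp (SeqIn s \<sigma>)
            (And (ExSeq (\<lambda>t. And (Ground (imm_succ s t)) (SeqIn t \<sigma>)))
                 (Finite_fm (\<lambda>t. And (Ground (imm_succ s t)) (SeqIn t \<sigma>)))))))"

definition Adfs_fm :: "((nat list, 'c) name, 'c) name \<Rightarrow> 'c fm" where
  "Adfs_fm \<Sigma> =
     And (AllSet (\<lambda>\<sigma>. Imp (SetIn \<sigma> \<Sigma>) (FsTree_fm \<sigma>)))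
         (AllSet (\<lambda>\<sigma>. AllSet (\<lambda>\<tau>.
            Imp (And (SetIn \<sigma> \<Sigma>) (And (SetIn \<tau> \<Sigma>) (Neg (EqSet \<sigma> \<tau>)))) (Finite_inter \<sigma> \<tau>))))"

text \<open>The ground model family \<open>\<T>\<close> and the ground model set \<open>I_plus \<T>\<close> enter via their check names;
  the union of two names evaluates to the union of their values.\<close>

definition Diagonalizes_fm ::
    "'c set \<Rightarrow> nat list set set \<Rightarrow> ((nat list, 'c) name, 'c) name \<Rightarrow> 'c fm" where
  "Diagonalizes_fm P \<T> \<Sigma> =
     And (Adfs_fm (check_fam P \<T> \<union> \<Sigma>))
         (AllSet (\<lambda>\<tau>. Imp (SetIn \<tau> (check_fam P (I_plus \<T>)))
            (ExSet (\<lambda>\<sigma>. And (SetIn \<sigma> \<Sigma>) (Neg (Finite_inter \<sigma> \<tau>))))))"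

section \<open>The generic family\<close>

definition S_gen :: "cond set \<Rightarrow> nat \<Rightarrow> nat list set" where
  "S_gen G i = {s. \<exists>(p, w)\<in>G. p (i, s) = Some True}"

definition S_name :: "nat list set set \<Rightarrow> nat \<Rightarrow> (nat list, cond) name" where
  "S_name \<T> i = {(s, (p, w)) | s p w. (p, w) \<in> TT \<T> \<and> p (i, s) = Some True}"

definition S_family_name :: "nat list set set \<Rightarrow> ((nat list, cond) name, cond) name" where
  "S_family_name \<T> = check (TT \<T>) (range (S_name \<T>))"

text \<open>The names denote what they should: their values under any nonempty set \<open>G\<close> of conditions
  (in particular under any filter) are \<open>S_gen G i\<close> and \<open>{S_gen G i | i}\<close>; check names denote the
  ground model sets and families they are formed from.\<close>

lemma val_S_name: "G \<subseteq> TT \<T> \<Longrightarrow> val G (S_name \<T> i) = S_gen G i"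
  by (fastforce simp: val_def S_name_def S_gen_def)

lemma val_check: "G \<subseteq> P \<Longrightarrow> G \<noteq> {} \<Longrightarrow> val G (check P A) = A"
  by (auto simp: val_def check_def)

lemma val_check_fam: "G \<subseteq> P \<Longrightarrow> G \<noteq> {} \<Longrightarrow> val_fam G (check_fam P \<A>) = \<A>"
  by (simp add: val_fam_def check_fam_def val_check image_image)

lemma val_S_family_name:
  "G \<subseteq> TT \<T> \<Longrightarrow> G \<noteq> {} \<Longrightarrow> val_fam G (S_family_name \<T>) = range (S_gen G)"
  by (simp add: val_fam_def S_family_name_def val_check image_image val_S_name)

lemma val_fam_Un: "val_fam G (\<Sigma> \<union> \<Sigma>') = val_fam G \<Sigma> \<union> val_fam G \<Sigma>'"
  by (auto simp: val_fam_def val_def)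

end

theory Submission
  imports Defs
begin

text \<open>A statement holds in every generic extension iff every condition forces it, and what is
  forced densely below a condition is forced by it (\<open>forces_densely\<close>). So the theorem
  is a collection of density arguments. The one notion that is not immediate to treat in this way
  is finiteness, which speaks of a name of a bijection; \<open>forces_Finite_fm\<close> replaces it
  by a bound in the ground model.

  A condition \<open>(p, w)\<close> decides finitely many trees up to some height and promises that
  finitely many \<open>f\<close> in \<open>W \<T>\<close> become branches, each of the tree with index \<open>w f\<close>. Apart from
  these promises its trees can be prolonged freely (\<open>cond_at_prolong\<close>). Hence the generic
  trees grow forever and split finitely. Given \<open>T\<close> in \<open>\<T>\<close>, every promised \<open>f\<close> leaves \<open>T\<close> at
  some point, while nodes on no promised branch can leave \<open>T\<close> at once, since \<open>T\<close> is finitely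
  splitting; so some stronger condition makes the generic tree disjoint from \<open>T\<close> at some level, and
  thereby above it (\<open>forces_finite_inter_ground\<close>). Two generic trees have disjoint sets of
  promised branches and are separated in the same way (\<open>forces_finite_inter_generic\<close>).

  The reason for allowing promises is maximality. If \<open>[T]\<close> is contained in \<open>W \<T>\<close>, a branch \<open>f\<close> of
  \<open>T\<close> can be promised to a generic tree whose index is not yet in use. This tree then contains all
  initial segments of \<open>f\<close>, so its intersection with \<open>T\<close> is infinite (\<open>forces_hits_positive\<close>).\<close>

section \<open>Working with the forcing relation\<close>

locale forcing_notion =
  fixes P :: "'c set" and le :: "'c \<Rightarrow> 'c \<Rightarrow> bool"
  assumes le_refl: "le p p"
    and le_trans: "le r q \<Longrightarrow> le q p \<Longrightarrow> le r p"
begin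

abbreviation forced_by (infix "\<Vdash>" 50) where
  "p \<Vdash> \<phi> \<equiv> forces P le \<phi> p"

abbreviation densely :: "'c \<Rightarrow> ('c \<Rightarrow> bool) \<Rightarrow> bool" where
  "densely \<equiv> dense_below P le"

lemma densely_antimono: "densely p D \<Longrightarrow> le q p \<Longrightarrow> densely q D"
  unfolding dense_below_def using le_trans by blast

lemma densely_mono: "densely p D \<Longrightarrow> (\<And>q. q \<in> P \<Longrightarrow> le q p \<Longrightarrow> D q \<Longrightarrow> E q) \<Longrightarrow> densely p E"
  unfolding dense_below_def using le_trans by meson

lemma densely_now: "(\<And>q. q \<in> P \<Longrightarrow> le q p \<Longrightarrow> D q) \<Longrightarrow> densely p D"
  unfolding dense_below_def using le_refl by blast

text \<open>Density composes like a monad: a dense set of conditions below each of which \<open>E\<close> is dense makes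
  \<open>E\<close> dense. Most arguments below pass to a dense set of better conditions in this way.\<close>

lemma densely_bind:
  assumes "densely p D" and "\<And>q. q \<in> P \<Longrightarrow> le q p \<Longrightarrow> D q \<Longrightarrow> densely q E"
  shows "densely p E"
  using assms unfolding dense_below_def by (meson le_refl le_trans)

lemma densely_ball:
  assumes "finite A"
    and "\<And>a. a \<in> A \<Longrightarrow> densely p (E a)"
    and "\<And>a q r. a \<in> A \<Longrightarrow> E a q \<Longrightarrow> le r q \<Longrightarrow> E a r"
  shows "densely p (\<lambda>q. \<forall>a\<in>A. E a q)"
  using assms
proof (induction A)
  case empty
  show ?case by (simp add: densely_now)
next
  case (insert a A)
  have "densely p (\<lambda>q. \<forall>a\<in>A. E a q)"
    using insert by blast
  then show ?case
  proof (rule densely_bind)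
    fix q assume q: "q \<in> P" "le q p" "\<forall>a\<in>A. E a q"
    have "densely q (E a)"
      using densely_antimono insert.prems(1) q(2) by blast
    then show "densely q (\<lambda>q. \<forall>a\<in>insert a A. E a q)"
      by (rule densely_mono) (use q(3) insert.prems(2) in blast)
  qed
qed

lemma forces_mono: "p \<Vdash> \<phi> \<Longrightarrow> le q p \<Longrightarrow> q \<Vdash> \<phi>"
proof (induction \<phi>)
  case (SetIn \<sigma> \<Sigma>)
  then show ?case by (auto simp: forces_mem_fam_def intro: densely_antimono)
next
  case (Neg \<phi>)
  then show ?case using le_trans by auto
qed (auto simp: forces_mem_def intro: densely_antimono)

text \<open>Whatever is forced densely below \<open>p\<close> is forced by \<open>p\<close>. This holds for atomic formulas because they
  are defined by density, and for negations because of \<open>forces_mono\<close>. Together with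
  \<open>forces_mono\<close> it is all that the rest needs to know about how the relation is built up: a
  formula may be checked after strengthening the condition arbitrarily often.\<close>

lemma forces_densely: "p \<in> P \<Longrightarrow> densely p (\<lambda>q. q \<Vdash> \<phi>) \<Longrightarrow> p \<Vdash> \<phi>"
proof (induction \<phi>)
  case (Ground b)
  then show ?case unfolding dense_below_def using le_refl by auto
next
  case (SeqIn s \<sigma>)
  then show ?case by (auto simp: forces_mem_def intro: densely_bind)
next
  case (PairIn x \<rho>)
  then show ?case by (auto simp: forces_mem_def intro: densely_bind)
next
  case (SetIn \<sigma> \<Sigma>)
  then show ?case by (auto simp: forces_mem_fam_def intro: densely_bind)
next
  case (Neg \<phi>)
  show ?case
  proof (simp, intro ballI impI)
    fix q assume q: "q \<in> P" "le q p"
    then obtain r where r: "r \<in> P" "le r q" "r \<Vdash> Neg \<phi>"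
      using Neg.prems(2) unfolding dense_below_def by blast
    then have "\<not> r \<Vdash> \<phi>"
      using le_refl by simp
    then show "\<not> q \<Vdash> \<phi>"
      using forces_mono r(2) by blast
  qed
next
  case (And \<phi> \<psi>)
  then have "densely p (\<lambda>q. q \<Vdash> \<phi>)" "densely p (\<lambda>q. q \<Vdash> \<psi>)"
    by (auto elim: densely_mono)
  then show ?case using And by simp
next
  case (AllNat \<Phi>)
  have "densely p (\<lambda>q. q \<Vdash> \<Phi> n)" for n
    using AllNat.prems(2) by (rule densely_mono) simp
  then show ?case using AllNat by simp
next
  case (AllSeq \<Phi>)
  have "densely p (\<lambda>q. q \<Vdash> \<Phi> n)" for n
    using AllSeq.prems(2) by (rule densely_mono) simp
  then show ?case using AllSeq by simp
next
  case (AllSet \<Phi>)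
  have "densely p (\<lambda>q. q \<Vdash> \<Phi> n)" for n
    using AllSet.prems(2) by (rule densely_mono) simp
  then show ?case using AllSet by simp
next
  case (AllRel \<Phi>)
  have "densely p (\<lambda>q. q \<Vdash> \<Phi> n)" for n
    using AllRel.prems(2) by (rule densely_mono) simp
  then show ?case using AllRel by simp
qed

lemma forces_Imp:
  assumes "p \<in> P"
  shows "p \<Vdash> Imp \<phi> \<psi> \<longleftrightarrow> (\<forall>q\<in>P. le q p \<longrightarrow> q \<Vdash> \<phi> \<longrightarrow> q \<Vdash> \<psi>)"
proof
  assume imp: "p \<Vdash> Imp \<phi> \<psi>"
  show "\<forall>q\<in>P. le q p \<longrightarrow> q \<Vdash> \<phi> \<longrightarrow> q \<Vdash> \<psi>"
  proof (intro ballI impI)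
    fix q assume q: "q \<in> P" "le q p" "q \<Vdash> \<phi>"
    have "\<exists>r'\<in>P. le r' r \<and> r' \<Vdash> \<psi>" if r: "r \<in> P" "le r q" for r
    proof -
      have "r \<Vdash> \<phi>" "le r p"
        using forces_mono le_trans q r by blast+
      then show ?thesis
        using imp r unfolding Imp_def by auto
    qed
    then show "q \<Vdash> \<psi>"
      by (intro forces_densely) (use q in \<open>auto simp: dense_below_def\<close>)
  qed
next
  assume "\<forall>q\<in>P. le q p \<longrightarrow> q \<Vdash> \<phi> \<longrightarrow> q \<Vdash> \<psi>"
  then show "p \<Vdash> Imp \<phi> \<psi>"
    unfolding Imp_def using le_refl by auto
qed

lemma forces_ExNat: "p \<Vdash> ExNat \<Phi> \<longleftrightarrow> densely p (\<lambda>q. \<exists>n. q \<Vdash> \<Phi> n)"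
  by (simp add: ExNat_def dense_below_def) blast

lemma forces_ExSeq: "p \<Vdash> ExSeq \<Psi> \<longleftrightarrow> densely p (\<lambda>q. \<exists>s. q \<Vdash> \<Psi> s)"
  by (simp add: ExSeq_def dense_below_def) blast

lemma forces_ExSet: "p \<Vdash> ExSet \<Theta> \<longleftrightarrow> densely p (\<lambda>q. \<exists>\<sigma>. q \<Vdash> \<Theta> \<sigma>)"
  by (simp add: ExSet_def dense_below_def) blast

lemma forces_ExRel: "p \<Vdash> ExRel \<Xi> \<longleftrightarrow> densely p (\<lambda>q. \<exists>\<rho>. q \<Vdash> \<Xi> \<rho>)"
  by (simp add: ExRel_def dense_below_def) blast

lemma forces_mem_check: "p \<in> P \<Longrightarrow> forces_mem P le x (check P A) p \<longleftrightarrow> x \<in> A"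
  unfolding forces_mem_def check_def dense_below_def using le_refl by auto

lemma forces_mem_fam_check:
  "forces_mem_fam P le \<sigma> (check P N) p \<longleftrightarrow> densely p (\<lambda>q. \<exists>\<tau>\<in>N. forces_eq P le \<sigma> \<tau> q)"
  unfolding forces_mem_fam_def check_def
  by (auto elim!: densely_mono) (use le_refl in blast)

lemma forces_mem_fam_Un:
  assumes "forces_mem_fam P le \<sigma> (\<Sigma> \<union> \<Sigma>') p"
  shows "densely p (\<lambda>q. forces_mem_fam P le \<sigma> \<Sigma> q \<or> forces_mem_fam P le \<sigma> \<Sigma>' q)"
proof -
  have now: "forces_mem_fam P le \<sigma> \<Sigma>'' q"
    if "r \<in> P" "(\<tau>, r) \<in> \<Sigma>''" "le q r" "forces_eq P le \<sigma> \<tau> q" for q r \<tau> \<Sigma>''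
  proof -
    have "forces_eq P le \<sigma> \<tau> q'" "le q' r" if "le q' q" for q'
      using that \<open>le q r\<close> \<open>forces_eq P le \<sigma> \<tau> q\<close> le_trans unfolding forces_eq_def by blast+
    then show ?thesis
      unfolding forces_mem_fam_def using that(1,2) by (intro densely_now) blast
  qed
  show ?thesis
    using assms unfolding forces_mem_fam_def[of _ _ _ "\<Sigma> \<union> \<Sigma>'"]
    by (rule densely_mono) (use now in blast)
qed

lemma forces_eq_refl: "forces_eq P le \<sigma> \<sigma> p"
  by (simp add: forces_eq_def)

lemma forces_eq_mono: "forces_eq P le \<sigma> \<tau> p \<Longrightarrow> le q p \<Longrightarrow> forces_eq P le \<sigma> \<tau> q"
  unfolding forces_eq_def using le_trans by blast

text \<open>Equal names are interchangeable. Since formulas contain meta-level functions there is no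
  substitution operation to induct on; instead, formulas that are forced by the same
  conditions below \<open>p\<close> form a congruence.\<close>

definition same_below :: "'c \<Rightarrow> 'c fm \<Rightarrow> 'c fm \<Rightarrow> bool" where
  "same_below p \<phi> \<psi> \<longleftrightarrow> (\<forall>q\<in>P. le q p \<longrightarrow> (q \<Vdash> \<phi> \<longleftrightarrow> q \<Vdash> \<psi>))"

lemma same_below_intros:
  "same_below p \<phi> \<phi>"
  "forces_eq P le \<sigma> \<tau> p \<Longrightarrow> same_below p (SeqIn s \<sigma>) (SeqIn s \<tau>)"
  "same_below p \<phi> \<phi>' \<Longrightarrow> same_below p (Neg \<phi>) (Neg \<phi>')"
  "same_below p \<phi> \<phi>' \<Longrightarrow> same_below p \<psi> \<psi>' \<Longrightarrow> same_below p (And \<phi> \<psi>) (And \<phi>' \<psi>')"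
  "(\<And>n. same_below p (\<Phi> n) (\<Phi>' n)) \<Longrightarrow> same_below p (AllNat \<Phi>) (AllNat \<Phi>')"
  "(\<And>s. same_below p (\<Psi> s) (\<Psi>' s)) \<Longrightarrow> same_below p (AllSeq \<Psi>) (AllSeq \<Psi>')"
  "(\<And>\<rho>. same_below p (\<Xi> \<rho>) (\<Xi>' \<rho>)) \<Longrightarrow> same_below p (AllRel \<Xi>) (AllRel \<Xi>')"
  unfolding same_below_def forces_eq_def using le_trans by (auto 0 3)

lemma same_below_Finite_fm:
  "(\<And>s. same_below p (\<Phi> s) (\<Phi>' s)) \<Longrightarrow> same_below p (Finite_fm \<Phi>) (Finite_fm \<Phi>')"
  unfolding Finite_fm_def Bij_fm_def Imp_def ExNat_def ExSeq_def ExRel_def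
  by (intro same_below_intros)

lemma FsTree_fm_cong:
  assumes "p \<in> P" and "forces_eq P le \<sigma> \<tau> p"
  shows "p \<Vdash> FsTree_fm \<sigma> \<longleftrightarrow> p \<Vdash> FsTree_fm \<tau>"
proof -
  have "same_below p (FsTree_fm \<sigma>) (FsTree_fm \<tau>)"
    unfolding FsTree_fm_def Imp_def ExSeq_def
    by (intro same_below_intros same_below_Finite_fm assms(2))
  then show ?thesis
    using assms(1) le_refl unfolding same_below_def by blast
qed

lemma Finite_inter_cong:
  assumes "p \<in> P" and "forces_eq P le \<sigma> \<sigma>' p" and "forces_eq P le \<tau> \<tau>' p"
  shows "p \<Vdash> Finite_inter \<sigma> \<tau> \<longleftrightarrow> p \<Vdash> Finite_inter \<sigma>' \<tau>'"
proof -
  have "same_below p (Finite_inter \<sigma> \<tau>) (Finite_inter \<sigma>' \<tau>')"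
    unfolding Finite_inter_def by (intro same_below_intros same_below_Finite_fm assms(2,3))
  then show ?thesis
    using assms(1) le_refl unfolding same_below_def by blast
qed

lemma Finite_inter_commute:
  assumes "p \<in> P"
  shows "p \<Vdash> Finite_inter \<sigma> \<tau> \<longleftrightarrow> p \<Vdash> Finite_inter \<tau> \<sigma>"
proof -
  have "same_below p (Finite_inter \<sigma> \<tau>) (Finite_inter \<tau> \<sigma>)"
    unfolding Finite_inter_def by (intro same_below_Finite_fm) (auto simp: same_below_def)
  then show ?thesis
    using assms le_refl unfolding same_below_def by blast
qed

lemma forces_EqSet:
  assumes "p \<in> P" and "forces_eq P le \<sigma> \<upsilon> p" and "forces_eq P le \<tau> \<upsilon> p"
  shows "p \<Vdash> EqSet \<sigma> \<tau>"
  using assms by (auto simp: EqSet_def Iff_def forces_Imp forces_eq_def)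

lemma densely_decides: "densely p (\<lambda>q. q \<Vdash> \<phi> \<or> q \<Vdash> Neg \<phi>)"
  unfolding dense_below_def using le_refl by auto

text \<open>Finiteness is absolute: no new finite subset of the ground model appears in the extension, so
  a set is finite there iff densely some ground model finite set bounds it. Given a name of a
  bijection with \<open>n\<close>, finitely many strengthenings decide its \<open>n\<close> values, which yields the bound.
  Conversely, below a condition that decides membership for each element of the bound, the
  set is a ground model set, and the check name of an enumeration of it names a bijection.
  All finiteness claims about the generic trees go through this criterion, so that names of
  bijections do not occur again.\<close>

lemma forces_Finite_fm:
  assumes "p \<in> P"
  shows "p \<Vdash> Finite_fm \<Phi> \<longleftrightarrow> densely p (\<lambda>q. \<exists>A. finite A \<and> (\<forall>s. s \<notin> A \<longrightarrow> q \<Vdash> Neg (\<Phi> s)))"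
    (is "_ \<longleftrightarrow> densely p ?bounded")
proof
  assume "p \<Vdash> Finite_fm \<Phi>"
  then have "densely p (\<lambda>q. \<exists>n. densely q (\<lambda>r. \<exists>\<rho>. r \<Vdash> Bij_fm n \<Phi> \<rho>))"
    by (simp add: Finite_fm_def forces_ExNat forces_ExRel)
  then show "densely p ?bounded"
  proof (rule densely_bind, elim exE)
    fix q n assume "densely q (\<lambda>r. \<exists>\<rho>. r \<Vdash> Bij_fm n \<Phi> \<rho>)"
    then show "densely q ?bounded"
    proof (rule densely_bind, elim exE)
      fix r \<rho> assume r: "r \<in> P" and bij: "r \<Vdash> Bij_fm n \<Phi> \<rho>"
      have range: "k < n" if "r' \<in> P" "le r' r" "r' \<Vdash> PairIn (k, s) \<rho>" for r' k s
        using bij r that by (auto simp: Bij_fm_def forces_Imp)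
      have total: "densely r' (\<lambda>q. \<exists>s. q \<Vdash> PairIn (k, s) \<rho>)" if "k < n" "r' \<in> P" "le r' r" for r' k
        using bij r that by (auto simp: Bij_fm_def forces_Imp forces_ExSeq)
      have unique: "s = t"
        if "r' \<in> P" "le r' r" "r' \<Vdash> PairIn (k, s) \<rho>" "r' \<Vdash> PairIn (k, t) \<rho>" for r' k s t
        using bij r that by (auto simp: Bij_fm_def forces_Imp)
      have onto: "densely r' (\<lambda>q. \<exists>k. q \<Vdash> PairIn (k, s) \<rho>)"
        if "r' \<in> P" "le r' r" "r' \<Vdash> \<Phi> s" for r' s
        using bij r that by (auto simp: Bij_fm_def forces_Imp forces_ExNat)
      have "densely r (\<lambda>q. \<forall>k\<in>{..<n}. \<exists>s. q \<Vdash> PairIn (k, s) \<rho>)"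
        by (rule densely_ball) (use total r le_refl forces_mono in blast)+
      then show "densely r ?bounded"
      proof (rule densely_mono)
        fix q assume q: "q \<in> P" "le q r" "\<forall>k\<in>{..<n}. \<exists>s. q \<Vdash> PairIn (k, s) \<rho>"
        then obtain h where h: "\<And>k. k < n \<Longrightarrow> q \<Vdash> PairIn (k, h k) \<rho>"
          by (metis lessThan_iff)
        have "s \<in> h ` {..<n}" if q': "q' \<in> P" "le q' q" "q' \<Vdash> \<Phi> s" for q' s
        proof -
          have "le q' r" using q q' le_trans by blast
          then obtain r' k where r': "r' \<in> P" "le r' q'" "r' \<Vdash> PairIn (k, s) \<rho>"
            using onto[OF q'(1) _ q'(3)] q' le_refl unfolding dense_below_def by blast
          have le: "le r' r" "le r' q"
            using le_trans r' q' \<open>le q' r\<close> by blast+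
          then have "k < n"
            using range r' by blast
          moreover have "r' \<Vdash> PairIn (k, h k) \<rho>"
            using h[OF \<open>k < n\<close>] forces_mono le by blast
          ultimately show ?thesis
            using unique[OF r'(1) le(1) r'(3)] by auto
        qed
        then show "?bounded q"
          by (intro exI[of _ "h ` {..<n}"]) auto
      qed
    qed
  qed
next
  assume "densely p ?bounded"
  then have "densely p (\<lambda>q. q \<Vdash> Finite_fm \<Phi>)"
  proof (rule densely_bind, elim exE conjE)
    fix q A assume q: "q \<in> P" and A: "finite A" "\<forall>s. s \<notin> A \<longrightarrow> q \<Vdash> Neg (\<Phi> s)"
    have "densely q (\<lambda>r. \<forall>s\<in>A. r \<Vdash> \<Phi> s \<or> r \<Vdash> Neg (\<Phi> s))"
      by (rule densely_ball) (use A densely_decides forces_mono in blast)+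
    then show "densely q (\<lambda>q. q \<Vdash> Finite_fm \<Phi>)"
    proof (rule densely_mono)
      fix r assume r: "r \<in> P" "le r q" "\<forall>s\<in>A. r \<Vdash> \<Phi> s \<or> r \<Vdash> Neg (\<Phi> s)"
      define B where "B = {s \<in> A. r \<Vdash> \<Phi> s}"
      have inB: "r' \<Vdash> \<Phi> s \<longleftrightarrow> s \<in> B" if "r' \<in> P" "le r' r" for r' s
      proof
        assume "r' \<Vdash> \<Phi> s"
        then have "\<not> r \<Vdash> Neg (\<Phi> s)"
          using that by auto
        then show "s \<in> B"
          using A(2) r forces_mono unfolding B_def by blast
      next
        assume "s \<in> B"
        then show "r' \<Vdash> \<Phi> s"
          using forces_mono that unfolding B_def by blast
      qed
      have "finite B"
        using A(1) by (simp add: B_def)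
      then obtain h where h: "bij_betw h {0..<card B} B"
        using ex_bij_betw_nat_finite by blast
      define \<rho> where "\<rho> = check P {(k, h k) | k. k < card B}"
      have mem: "r' \<Vdash> PairIn (k, s) \<rho> \<longleftrightarrow> k < card B \<and> s = h k" if "r' \<in> P" for r' k s
        using that by (auto simp: \<rho>_def forces_mem_check)
      have hB: "k < card B \<Longrightarrow> h k \<in> B" for k
        using h by (auto simp: bij_betw_def)
      have surj: "s \<in> B \<Longrightarrow> \<exists>k<card B. s = h k" for s
        using h unfolding bij_betw_def by fastforce
      have inj: "k < card B \<Longrightarrow> l < card B \<Longrightarrow> h k = h l \<Longrightarrow> k = l" for k l
        using h by (auto simp: bij_betw_def inj_on_def)
      have "r \<Vdash> Bij_fm (card B) \<Phi> \<rho>"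
        using r(1) inB hB inj unfolding Bij_fm_def
        by (auto simp: forces_Imp forces_ExNat forces_ExSeq mem
            simp del: forces.simps(3) intro!: densely_now dest!: surj)
      then have "r' \<Vdash> Bij_fm (card B) \<Phi> \<rho>" if "le r' r" for r'
        using forces_mono that by blast
      then show "r \<Vdash> Finite_fm \<Phi>"
        unfolding Finite_fm_def forces_ExNat forces_ExRel
        using le_trans by (intro densely_now exI) blast
    qed
  qed
  then show "p \<Vdash> Finite_fm \<Phi>"
    using forces_densely assms by blast
qed

lemma forces_FsTree_check:
  assumes "p \<in> P" and "fs_tree T"
  shows "p \<Vdash> FsTree_fm (check P T)"
proof -
  have fin: "q \<Vdash> Finite_fm (\<lambda>t. And (Ground (imm_succ s t)) (SeqIn t (check P T)))"
    if "q \<in> P" "s \<in> T" for q s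
    unfolding forces_Finite_fm[OF that(1)]
    using assms(2) that(2)
    by (intro densely_now exI[of _ "{t. imm_succ s t \<and> t \<in> T}"])
      (auto simp: fs_tree_def forces_mem_check)
  show ?thesis
    using assms fin unfolding FsTree_fm_def
    by (auto simp: fs_tree_def forces_Imp forces_ExSeq forces_mem_check intro!: densely_now)
qed

lemma forces_Finite_inter_check:
  assumes "p \<in> P" and "finite (S \<inter> T)"
  shows "p \<Vdash> Finite_inter (check P S) (check P T)"
  unfolding Finite_inter_def forces_Finite_fm[OF assms(1)]
  by (intro densely_now exI[of _ "S \<inter> T"]) (use assms(2) in \<open>auto simp: forces_mem_check\<close>)

text \<open>An infinite ground model subset of the intersection escapes every finite bound.\<close>

lemma forces_infinite_inter:
  assumes "infinite A"
    and "\<And>s. s \<in> A \<Longrightarrow> p \<Vdash> SeqIn s \<sigma>" and "\<And>s. s \<in> A \<Longrightarrow> p \<Vdash> SeqIn s \<tau>"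
  shows "p \<Vdash> Neg (Finite_inter \<sigma> \<tau>)"
proof -
  have False if q: "q \<in> P" "le q p" "q \<Vdash> Finite_inter \<sigma> \<tau>" for q
  proof -
    obtain r B where r: "r \<in> P" "le r q" "finite B"
      and B: "\<And>s. s \<notin> B \<Longrightarrow> r \<Vdash> Neg (And (SeqIn s \<sigma>) (SeqIn s \<tau>))"
      using q le_refl unfolding Finite_inter_def forces_Finite_fm[OF q(1)] dense_below_def
      by meson
    obtain s where s: "s \<in> A" "s \<notin> B"
      using assms(1) r(3) by (meson finite_subset subsetI)
    have "r \<Vdash> SeqIn s \<sigma>" "r \<Vdash> SeqIn s \<tau>"
      using assms(2,3)[OF s(1)] forces_mono le_trans r(2) q(2) by blast+
    then show False
      using B[OF s(2)] r(1) le_refl by auto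
  qed
  then show ?thesis by auto
qed

end

section \<open>Finite trees and their prolongations\<close>

lemma length_restr [simp]: "length (restr f n) = n"
  by (simp add: restr_def)

lemma take_restr: "take k (restr f n) = restr f (min k n)"
  by (simp add: restr_def take_map min_def)

lemma restr_Suc: "restr f (Suc n) = restr f n @ [f n]"
  by (simp add: restr_def)

lemma inj_restr: "inj (restr f)"
  by (metis injI length_restr)

lemma prefix_eq_take: "prefix s t \<Longrightarrow> s = take (length s) t"
  by (auto simp: prefix_def)

lemma restr_separates: "f \<noteq> g \<Longrightarrow> \<exists>k. \<forall>m\<ge>k. restr f m \<noteq> restr g m"
proof -
  assume "f \<noteq> g"
  then obtain k where "f k \<noteq> g k" by auto
  then have "restr f m \<noteq> restr g m" if "m \<ge> Suc k" for m
    using that by (auto simp: restr_def)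
  then show ?thesis by blast
qed

text \<open>By closure under initial segments, a sequence that leaves a tree never returns. This and
  \<open>restr_separates\<close> are the two ways in which a promised branch is eventually disposed of.\<close>

lemma eventually_leaves_tree:
  assumes "fs_tree T" and "f \<notin> branches T"
  shows "\<exists>k. \<forall>m\<ge>k. restr f m \<notin> T"
proof -
  obtain k where k: "restr f k \<notin> T"
    using assms(2) by (auto simp: branches_def)
  have "restr f m \<notin> T" if "m \<ge> k" for m
  proof
    assume "restr f m \<in> T"
    moreover have "prefix (restr f k) (restr f m)"
      using take_restr[of k f m] that by (metis min.absorb1 take_is_prefix)
    ultimately show False
      using assms(1) k unfolding fs_tree_def by blast
  qed
  then show ?thesis by blast
qed

lemma finite_uniform_threshold:
  assumes "finite A" and "\<And>a. a \<in> A \<Longrightarrow> \<exists>k. \<forall>m\<ge>k. Q a (m::nat)"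
  shows "\<exists>k. \<forall>m\<ge>k. \<forall>a\<in>A. Q a m"
proof -
  obtain K where K: "\<And>a. a \<in> A \<Longrightarrow> \<forall>m\<ge>K a. Q a m"
    using assms(2) by metis
  have "K a \<le> Max (insert 0 (K ` A))" if "a \<in> A" for a
    using assms(1) that by simp
  then show ?thesis
    using K by (meson order_trans)
qed

lemma fs_ntree_prefix: "fs_ntree n T \<Longrightarrow> prefix s t \<Longrightarrow> t \<in> T \<Longrightarrow> s \<in> T"
  unfolding fs_ntree_def by blast

lemma fs_tree_take: "fs_tree T \<Longrightarrow> t \<in> T \<Longrightarrow> take k t \<in> T"
  unfolding fs_tree_def using take_is_prefix by blast

lemma Nil_in_fs_ntree: "fs_ntree n T \<Longrightarrow> [] \<in> T"
  unfolding fs_ntree_def using Nil_prefix by blast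

lemma finite_fs_ntree:
  assumes "fs_ntree n T"
  shows "finite T"
proof -
  have "finite {t \<in> T. length t = k}" if "k \<le> n" for k
    using that
  proof (induction k)
    case 0
    have "{t \<in> T. length t = 0} \<subseteq> {[]}" by auto
    then show ?case by (rule finite_subset) simp
  next
    case (Suc k)
    have "{t \<in> T. length t = Suc k} \<subseteq>
        (\<Union>s\<in>{t \<in> T. length t = k}. {t. imm_succ s t \<and> t \<in> T})"
    proof
      fix t assume "t \<in> {t \<in> T. length t = Suc k}"
      then have t: "t \<in> T" "length t = Suc k" by auto
      then have "t = butlast t @ [last t]"
        by (metis append_butlast_last_id length_0_conv nat.simps(3))
      then have "imm_succ (butlast t) t" "prefix (butlast t) t"
        unfolding imm_succ_def prefix_def by blast+
      then show "t \<in> (\<Union>s\<in>{t \<in> T. length t = k}. {t. imm_succ s t \<and> t \<in> T})"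
        using t fs_ntree_prefix[OF assms] by (intro UN_I[of "butlast t"]) auto
    qed
    moreover have "finite (\<Union>s\<in>{t \<in> T. length t = k}. {t. imm_succ s t \<and> t \<in> T})"
      using Suc assms unfolding fs_ntree_def by auto
    ultimately show ?case by (rule finite_subset)
  qed
  moreover have "T = (\<Union>k\<le>n. {t \<in> T. length t = k})"
    using assms unfolding fs_ntree_def by auto
  ultimately show ?thesis by (metis (no_types, lifting) atMost_iff finite_UN_I finite_atMost)
qed

text \<open>The tree \<open>B\<close> of height \<open>n\<close> grown to height \<open>m\<close>: the branches in \<open>H\<close> are followed, and above each
  node of level \<open>n\<close> the constant sequence \<open>c\<close> is appended. The latter gives every node a successor,
  also where no branch in \<open>H\<close> passes, and it leaves the value \<open>c\<close> free, to be chosen such that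
  the new nodes avoid a given set.\<close>

definition prolong ::
    "nat \<Rightarrow> nat \<Rightarrow> (nat \<Rightarrow> nat) set \<Rightarrow> nat \<Rightarrow> nat list set \<Rightarrow> nat list set" where
  "prolong n m H c B = {t. length t \<le> m \<and> take n t \<in> B \<and>
     (length t \<le> n \<or> (\<exists>f\<in>H. t = restr f (length t)) \<or> drop n t = replicate (length t - n) c)}"

lemma prolong_old: "n \<le> m \<Longrightarrow> length t \<le> n \<Longrightarrow> t \<in> prolong n m H c B \<longleftrightarrow> t \<in> B"
  by (auto simp: prolong_def)

lemma restr_in_prolong: "n \<le> m \<Longrightarrow> restr f n \<in> B \<Longrightarrow> f \<in> H \<Longrightarrow> restr f m \<in> prolong n m H c B"
  by (auto simp: prolong_def take_restr min_def)

lemma prolong_top: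
  assumes "t \<in> prolong n m H c B" and "length t = m" and "n < m"
  shows "(\<exists>f\<in>H. t = restr f m) \<or> take n t \<in> B \<and> t = take n t @ replicate (m - n) c"
proof -
  have "take n t \<in> B" and "(\<exists>f\<in>H. t = restr f m) \<or> drop n t = replicate (m - n) c"
    using assms by (auto simp: prolong_def)
  then show ?thesis
    by (metis append_take_drop_id)
qed

lemma fs_ntree_prolong:
  assumes B: "fs_ntree n B" and H: "finite H" and "n \<le> m"
  shows "fs_ntree m (prolong n m H c B)"
proof -
  let ?T = "prolong n m H c B"
  have "[] \<in> ?T"
    using Nil_in_fs_ntree[OF B] by (simp add: prolong_def)
  moreover have "s \<in> ?T" if "prefix s t" "t \<in> ?T" for s t
  proof -
    define k where "k = min (length s) (length t)"
    have s: "s = take k t" and k: "k \<le> length t"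
      using prefix_eq_take[OF that(1)] by (auto simp: k_def min_def)
    have len: "length s = k"
      using k unfolding s by simp
    have "prefix (take n s) (take n t)"
      using s by (metis take_is_prefix take_take min.commute)
    then have "take n s \<in> B"
      using that(2) fs_ntree_prefix[OF B] by (auto simp: prolong_def)
    moreover have "s = restr f (length s)" if "t = restr f (length t)" for f
      using arg_cong[OF that, of "take k"] k unfolding len by (simp add: take_restr s)
    moreover have "drop n s = replicate (length s - n) c" if "drop n t = replicate (length t - n) c"
      using that s k by (simp add: drop_take min_def)
    ultimately show ?thesis
      using that(2) s k by (auto simp: prolong_def)
  qed
  moreover have "\<exists>u. imm_succ t u \<and> u \<in> ?T" if t: "t \<in> ?T" "length t < m" for t
  proof (cases "length t < n")
    case True
    then have "t \<in> B"
      using t by (simp add: prolong_def)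
    then obtain u where u: "imm_succ t u" "u \<in> B"
      using B True unfolding fs_ntree_def by blast
    then have "u \<in> ?T"
      using True \<open>n \<le> m\<close> by (subst prolong_old) (auto simp: imm_succ_def)
    then show ?thesis using u by blast
  next
    case False
    then have "(\<exists>f\<in>H. t = restr f (length t)) \<or> drop n t = replicate (length t - n) c"
      using t by (auto simp: prolong_def)
    then show ?thesis
    proof (elim disjE bexE)
      fix f assume f: "f \<in> H" "t = restr f (length t)"
      then have "t @ [f (length t)] = restr f (length (t @ [f (length t)]))"
        by (simp add: restr_Suc)
      moreover have "take n (t @ [f (length t)]) \<in> B" "length (t @ [f (length t)]) \<le> m"
        using False t by (simp_all add: prolong_def)
      ultimately have "t @ [f (length t)] \<in> ?T"
        using f(1) unfolding prolong_def by blast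
      then show ?thesis unfolding imm_succ_def by blast
    next
      assume c: "drop n t = replicate (length t - n) c"
      have "replicate (length t - n) c @ [c] = replicate (length t + 1 - n) c"
        using False by (simp add: replicate_append_same Suc_diff_le)
      then have "t @ [c] \<in> ?T"
        using False t c by (auto simp: prolong_def)
      then show ?thesis unfolding imm_succ_def by blast
    qed
  qed
  moreover have "finite {u. imm_succ t u \<and> u \<in> ?T}" if t: "t \<in> ?T" "length t < m" for t
  proof (cases "length t < n")
    case True
    then have "t \<in> B"
      using t by (simp add: prolong_def)
    then have "finite {u. imm_succ t u \<and> u \<in> B}"
      using B True unfolding fs_ntree_def by blast
    moreover have "{u. imm_succ t u \<and> u \<in> ?T} \<subseteq> {u. imm_succ t u \<and> u \<in> B}"
      using True by (auto simp: prolong_def imm_succ_def)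
    ultimately show ?thesis by (rule rev_finite_subset)
  next
    case False
    have "{u. imm_succ t u \<and> u \<in> ?T} \<subseteq> (\<lambda>k. t @ [k]) ` insert c ((\<lambda>f. f (length t)) ` H)"
    proof
      fix u assume "u \<in> {u. imm_succ t u \<and> u \<in> ?T}"
      then obtain k where u: "u = t @ [k]" "u \<in> ?T"
        by (auto simp: imm_succ_def)
      have "k = c" if "drop n t @ [k] = replicate (Suc (length t) - n) c"
        using that False by (metis Suc_diff_le append_same_eq last_replicate last_snoc nat.simps(3) not_less)
      moreover have "k = f (length t)" if "t @ [k] = restr f (Suc (length t))" for f
        using that by (simp add: restr_Suc)
      ultimately show "u \<in> (\<lambda>k. t @ [k]) ` insert c ((\<lambda>f. f (length t)) ` H)"
        using u False by (auto simp: prolong_def)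
    qed
    then show ?thesis
      by (rule finite_subset) (simp add: H)
  qed
  moreover have "?T \<subseteq> {t. length t \<le> m}"
    by (auto simp: prolong_def)
  ultimately show ?thesis
    unfolding fs_ntree_def by blast
qed

lemma fs_ntree_root: "fs_ntree 0 {[]}"
  by (auto simp: fs_ntree_def)

lemma fs_tree_has_branch:
  assumes "fs_tree T"
  shows "\<exists>f. f \<in> branches T"
proof -
  define next_entry where "next_entry s = (SOME k. s @ [k] \<in> T)" for s
  define g where "g = rec_nat [] (\<lambda>_ s. s @ [next_entry s])"
  define f where "f n = next_entry (g n)" for n
  have step: "s @ [next_entry s] \<in> T" if "s \<in> T" for s
    using assms that someI_ex[of "\<lambda>k. s @ [k] \<in> T"]
    unfolding fs_tree_def imm_succ_def next_entry_def by blast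
  have "[] \<in> T"
    using assms Nil_prefix unfolding fs_tree_def by blast
  then have "g n \<in> T" for n
    by (induction n) (simp_all add: g_def step)
  moreover have "restr f n = g n" for n
    by (induction n) (simp_all add: g_def f_def restr_Suc, simp add: restr_def)
  ultimately have "f \<in> branches T"
    by (simp add: branches_def)
  then show ?thesis
    by (rule exI[of _ f])
qed

section \<open>Extending conditions\<close>

locale tree_forcing =
  fixes \<T> :: "nat list set set"
  assumes adfs: "adfs \<T>"

sublocale tree_forcing \<subseteq> forcing_notion "TT \<T>" TT_le
  by unfold_locales (auto simp: TT_le_def intro: map_le_trans)

context tree_forcing
begin

notation forced_by (infix "\<Vdash>" 50)

text \<open>\<open>F\<close> and \<open>n\<close> are carried along explicitly because for \<open>F = {}\<close> the height \<open>n\<close> cannot be recovered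
  from \<open>p\<close>.\<close>

definition cond_at :: "nat set \<Rightarrow> nat \<Rightarrow> tcond \<Rightarrow> ((nat \<Rightarrow> nat) \<rightharpoonup> nat) \<Rightarrow> bool" where
  "cond_at F n p w \<longleftrightarrow> tree_cond F n p \<and> finite (dom w) \<and> dom w \<subseteq> W \<T> \<and>
     (\<forall>f i. w f = Some i \<longrightarrow> i \<notin> F \<or> restr f n \<in> level_tree p i)"

lemma TT_iff: "(p, w) \<in> TT \<T> \<longleftrightarrow> (\<exists>F n. cond_at F n p w)"
  by (simp add: TT_def cond_at_def)

lemma cond_at_fs_ntree: "cond_at F n p w \<Longrightarrow> i \<in> F \<Longrightarrow> fs_ntree n (level_tree p i)"
  by (simp add: cond_at_def tree_cond_def)

lemma cond_at_defined:
  "cond_at F n p w \<Longrightarrow> i \<in> F \<Longrightarrow> length s \<le> n \<Longrightarrow> p (i, s) = Some (s \<in> level_tree p i)"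
proof -
  assume "cond_at F n p w" "i \<in> F" "length s \<le> n"
  then have "(i, s) \<in> dom p"
    by (simp add: cond_at_def tree_cond_def)
  then show ?thesis
    by (auto simp: level_tree_def)
qed

lemma finite_promised: "cond_at F n p w \<Longrightarrow> finite {f. w f = Some i}"
  by (rule finite_subset[of _ "dom w"]) (auto simp: cond_at_def)

text \<open>The only obligations of a condition are its finitely many promises \<open>w f = Some i\<close>, that \<open>f\<close> be a
  branch of the \<open>i\<close>-th tree. So every tree may be prolonged to any height along its promised
  branches and, elsewhere, by a constant \<open>c i\<close> of our choice, and new trees may be started. All
  dense sets needed below arise from this lemma by choosing \<open>m\<close> and \<open>c\<close>.\<close>

lemma cond_at_prolong:
  assumes cond: "cond_at F n p w" and F': "finite F'" "F \<subseteq> F'" and "n \<le> m"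
  shows "\<exists>p'. cond_at F' m p' w \<and> p \<subseteq>\<^sub>m p' \<and>
    (\<forall>i\<in>F. level_tree p' i = prolong n m {f. w f = Some i} (c i) (level_tree p i))"
proof -
  \<comment> \<open>A tree with a new index \<open>i\<close> is grown from its root, which promises cannot contradict.\<close>
  define k where "k i = (if i \<in> F then n else 0)" for i
  define B where "B i = (if i \<in> F then level_tree p i else {[]})" for i
  define E where "E i = prolong (k i) m {f. w f = Some i} (c i) (B i)" for i
  define p' :: tcond where
    "p' = (\<lambda>(i, s). if i \<in> F' \<and> length s \<le> m then Some (s \<in> E i) else None)"
  have km: "k i \<le> m" for i
    using \<open>n \<le> m\<close> by (simp add: k_def)
  have B: "fs_ntree (k i) (B i)" for i
    using cond_at_fs_ntree[OF cond] fs_ntree_root by (simp add: k_def B_def)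
  have E: "fs_ntree m (E i)" for i
    unfolding E_def by (intro fs_ntree_prolong B finite_promised[OF cond] km)
  have level: "level_tree p' i = E i" if "i \<in> F'" for i
    using E[of i] that by (auto simp: level_tree_def p'_def fs_ntree_def)
  have "dom p' = F' \<times> {s. length s \<le> m}"
    by (auto simp: p'_def split: if_splits)
  then have "tree_cond F' m p'"
    using F' level E by (simp add: tree_cond_def)
  moreover have "restr f m \<in> level_tree p' i" if "w f = Some i" "i \<in> F'" for f i
  proof -
    have "restr f (k i) \<in> B i"
      using cond that(1) by (auto simp: cond_at_def k_def B_def restr_def)
    then show ?thesis
      using level[OF that(2)] restr_in_prolong[OF km] that(1) by (simp add: E_def)
  qed
  ultimately have "cond_at F' m p' w"
    using cond unfolding cond_at_def by blast
  moreover have "p \<subseteq>\<^sub>m p'"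
  proof (unfold map_le_def, intro ballI)
    fix x assume x: "x \<in> dom p"
    obtain i s where [simp]: "x = (i, s)" by force
    have dom: "i \<in> F" "length s \<le> n"
      using x cond by (auto simp: cond_at_def tree_cond_def)
    then have "s \<in> E i \<longleftrightarrow> s \<in> level_tree p i"
      using prolong_old[OF \<open>n \<le> m\<close>] by (simp add: E_def k_def B_def)
    then show "p x = p' x"
      using cond_at_defined[OF cond dom] dom F' \<open>n \<le> m\<close> by (auto simp: p'_def)
  qed
  moreover have "\<forall>i\<in>F. level_tree p' i = prolong n m {f. w f = Some i} (c i) (level_tree p i)"
    using level F' by (auto simp: E_def k_def B_def)
  ultimately show ?thesis
    by (intro exI[of _ p'] conjI)
qed

lemma extend_domain:
  assumes "q \<in> TT \<T>" and "finite I"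
  obtains F n p where "cond_at F n p (snd q)" "(p, snd q) \<in> TT \<T>" "TT_le (p, snd q) q"
    "I \<subseteq> F" "N \<le> n"
proof -
  obtain p w where q: "q = (p, w)" by force
  obtain F n where c: "cond_at F n p w"
    using assms(1) q TT_iff by auto
  have "finite (F \<union> I)"
    using c assms(2) by (auto simp: cond_at_def tree_cond_def)
  then obtain p' where p': "cond_at (F \<union> I) (max n N) p' w" "p \<subseteq>\<^sub>m p'"
    using cond_at_prolong[OF c _ Un_upper1 max.cobounded1] by blast
  then have "(p', w) \<in> TT \<T>"
    using TT_iff by blast
  then show thesis
    using that[of "F \<union> I" "max n N" p'] p' q by (simp add: TT_le_def)
qed

lemma cond_prefix:
  assumes "q \<in> TT \<T>" and "fst q (i, t) = Some True" and "prefix s t"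
  shows "fst q (i, s) = Some True"
proof -
  obtain p w F n where q: "q = (p, w)" and c: "cond_at F n p w"
    using assms(1) TT_iff by (metis surj_pair)
  have "(i, t) \<in> dom p"
    using assms(2) q by auto
  then have i: "i \<in> F"
    using c by (auto simp: cond_at_def tree_cond_def)
  show ?thesis
    using fs_ntree_prefix[OF cond_at_fs_ntree[OF c i] assms(3)] assms(2) q
    by (simp add: level_tree_def)
qed

text \<open>A condition of height \<open>n\<close> decides the \<open>i\<close>-th tree up to level \<open>n\<close>; hence initial segments of
  length \<open>n\<close> of nodes that are added later already belong to it.\<close>

lemma level_tree_decided:
  assumes c: "cond_at F n p w" and i: "i \<in> F"
    and q: "q \<in> TT \<T>" "TT_le q (p, w)" and t: "fst q (i, t) = Some True"
  shows "take n t \<in> level_tree p i"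
proof -
  have "fst q (i, take n t) = Some True"
    using cond_prefix[OF q(1) t] take_is_prefix by blast
  moreover have p: "p (i, take n t) = Some (take n t \<in> level_tree p i)"
    using cond_at_defined[OF c i] by simp
  moreover have "fst q (i, take n t) = p (i, take n t)"
    using q(2) p unfolding TT_le_def map_le_def by (metis domI fst_conv)
  ultimately show ?thesis by simp
qed

section \<open>Density arguments for the generic trees\<close>

lemma forces_S_name:
  assumes "q \<in> TT \<T>"
  shows "q \<Vdash> SeqIn s (S_name \<T> i) \<longleftrightarrow> densely q (\<lambda>r. fst r (i, s) = Some True)"
proof -
  have "fst r (i, s) = Some True" if "TT_le r (p, w)" "p (i, s) = Some True" for r p w
    using that unfolding TT_le_def by (metis domI fst_conv map_le_def)
  moreover have "\<exists>r'\<in>TT \<T>. (s, r') \<in> S_name \<T> i \<and> TT_le r r'"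
    if "r \<in> TT \<T>" "fst r (i, s) = Some True" for r
    using that le_refl by (cases r) (auto simp: S_name_def)
  ultimately show ?thesis
    by (auto simp: forces_mem_def S_name_def elim!: densely_mono)
qed

lemma forces_S_name_now:
  assumes "q \<in> TT \<T>" and "fst q (i, s) = Some True"
  shows "q \<Vdash> SeqIn s (S_name \<T> i)"
proof -
  have "fst r (i, s) = Some True" if "TT_le r q" for r
    using that assms(2) unfolding TT_le_def by (metis domI map_le_def)
  then show ?thesis
    unfolding forces_S_name[OF assms(1)] by (intro densely_now)
qed

lemma forced_in_S_name_decided:
  assumes c: "cond_at F n p w" and i: "i \<in> F"
    and q: "q \<in> TT \<T>" "TT_le q (p, w)" and t: "q \<Vdash> SeqIn t (S_name \<T> i)"
  shows "take n t \<in> level_tree p i"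
proof -
  obtain r where "r \<in> TT \<T>" "TT_le r q" "fst r (i, t) = Some True"
    using t q(1) le_refl unfolding forces_S_name[OF q(1)] dense_below_def by blast
  then show ?thesis
    using level_tree_decided[OF c i] le_trans q(2) by blast
qed

text \<open>Each clause of being a finitely splitting tree concerns levels up to some \<open>N\<close>, and densely a
  condition has \<open>i\<close> in its domain and height at least \<open>N\<close>. It then decides these levels to be those of
  a finitely splitting tree of finite height.\<close>

lemma forces_FsTree_S_name:
  assumes "q \<in> TT \<T>"
  shows "q \<Vdash> FsTree_fm (S_name \<T> i)"
proof -
  have in_dom: "\<exists>F n p. (p, snd q) \<in> TT \<T> \<and> TT_le (p, snd q) q \<and> cond_at F n p (snd q) \<and> i \<in> F \<and> N \<le> n"
    if "q \<in> TT \<T>" for q N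
    by (rule extend_domain[OF that, of "{i}" N]) auto
  have root: "densely q (\<lambda>r. \<exists>s. r \<Vdash> SeqIn s (S_name \<T> i))"
    unfolding dense_below_def
  proof (intro ballI impI)
    fix q' assume "q' \<in> TT \<T>"
    then obtain F n p where p: "(p, snd q') \<in> TT \<T>" "TT_le (p, snd q') q'"
      and c: "cond_at F n p (snd q')" and i: "i \<in> F"
      using in_dom by meson
    have "p (i, []) = Some True"
      using cond_at_defined[OF c i] Nil_in_fs_ntree[OF cond_at_fs_ntree[OF c i]] by simp
    then have "(p, snd q') \<Vdash> SeqIn [] (S_name \<T> i)"
      using forces_S_name_now[OF p(1)] by simp
    then show "\<exists>r\<in>TT \<T>. TT_le r q' \<and> (\<exists>s. r \<Vdash> SeqIn s (S_name \<T> i))"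
      using p by blast
  qed
  have closed: "r \<Vdash> SeqIn s (S_name \<T> i)"
    if "r \<in> TT \<T>" "prefix s t" "r \<Vdash> SeqIn t (S_name \<T> i)" for r s t
    using that(3) unfolding forces_S_name[OF that(1)]
    by (rule densely_mono) (use cond_prefix that(2) in blast)
  have branching: "densely r (\<lambda>r'. (\<exists>t. imm_succ s t \<and> r' \<Vdash> SeqIn t (S_name \<T> i)) \<and>
      (\<exists>A. finite A \<and> (\<forall>t. t \<notin> A \<longrightarrow> r' \<Vdash> Neg (And (Ground (imm_succ s t)) (SeqIn t (S_name \<T> i))))))"
    if r: "r \<in> TT \<T>" "r \<Vdash> SeqIn s (S_name \<T> i)" for r s
    unfolding dense_below_def
  proof (intro ballI impI)
    fix q' assume q': "q' \<in> TT \<T>" "TT_le q' r"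
    obtain F n p where p: "(p, snd q') \<in> TT \<T>" "TT_le (p, snd q') q'"
      and c: "cond_at F n p (snd q')" and i: "i \<in> F" and n: "Suc (length s) \<le> n"
      using in_dom[OF q'(1)] by meson
    note tree = cond_at_fs_ntree[OF c i]
    have "(p, snd q') \<Vdash> SeqIn s (S_name \<T> i)"
      using r(2) forces_mono le_trans p(2) q'(2) by blast
    then have s: "s \<in> level_tree p i"
      using forced_in_S_name_decided[OF c i p(1) le_refl] n by fastforce
    then obtain t where t: "imm_succ s t" "t \<in> level_tree p i"
      using tree n unfolding fs_ntree_def by (meson Suc_le_lessD)
    have "(p, snd q') \<Vdash> SeqIn t (S_name \<T> i)"
      using t(2) forces_S_name_now[OF p(1)] by (simp add: level_tree_def)
    moreover have "finite (level_tree p i)"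
      using finite_fs_ntree[OF tree] .
    moreover have "u \<in> level_tree p i"
      if "q'' \<in> TT \<T>" "TT_le q'' (p, snd q')" "imm_succ s u" "q'' \<Vdash> SeqIn u (S_name \<T> i)" for q'' u
      using forced_in_S_name_decided[OF c i that(1,2,4)] that(3) n by (auto simp: imm_succ_def)
    ultimately show "\<exists>r'\<in>TT \<T>. TT_le r' q' \<and>
      (\<exists>t. imm_succ s t \<and> r' \<Vdash> SeqIn t (S_name \<T> i)) \<and>
      (\<exists>A. finite A \<and> (\<forall>t. t \<notin> A \<longrightarrow> r' \<Vdash> Neg (And (Ground (imm_succ s t)) (SeqIn t (S_name \<T> i)))))"
      using p t(1) by (intro bexI[of _ "(p, snd q')"] conjI exI[of _ t] exI[of _ "level_tree p i"]) auto
  qed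
  have succ: "r \<Vdash> ExSeq (\<lambda>t. And (Ground (imm_succ s t)) (SeqIn t (S_name \<T> i)))"
    and fin: "r \<Vdash> Finite_fm (\<lambda>t. And (Ground (imm_succ s t)) (SeqIn t (S_name \<T> i)))"
    if "r \<in> TT \<T>" "r \<Vdash> SeqIn s (S_name \<T> i)" for r s
    unfolding forces_ExSeq forces_Finite_fm[OF that(1)]
    by (rule densely_mono[OF branching[OF that]]; auto)+
  show ?thesis
    unfolding FsTree_fm_def forces.simps(6,8)
    using root closed succ fin assms by (auto simp: forces_ExSeq forces_Imp simp del: forces.simps(2))
qed

text \<open>Sealing an intersection: if no node of level \<open>m\<close> of the \<open>i\<close>-th tree is an initial segment of a
  possible element of \<open>\<tau>\<close>, the intersection is confined to the finite tree that the
  condition has already decided.\<close>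

lemma forces_Finite_inter_S_name:
  assumes c: "cond_at F m p w" and i: "i \<in> F"
    and avoid: "\<And>q s. q \<in> TT \<T> \<Longrightarrow> TT_le q (p, w) \<Longrightarrow> q \<Vdash> SeqIn s \<tau> \<Longrightarrow> m \<le> length s \<Longrightarrow>
      take m s \<notin> level_tree p i"
  shows "(p, w) \<Vdash> Finite_inter (S_name \<T> i) \<tau>"
proof -
  have p: "(p, w) \<in> TT \<T>"
    using c TT_iff by blast
  have "s \<in> level_tree p i"
    if q: "q \<in> TT \<T>" "TT_le q (p, w)" "q \<Vdash> SeqIn s (S_name \<T> i)" "q \<Vdash> SeqIn s \<tau>" for q s
  proof -
    have "take m s \<in> level_tree p i"
      using forced_in_S_name_decided[OF c i q(1-3)] .
    moreover from this have "\<not> m \<le> length s"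
      using avoid q by blast
    ultimately show ?thesis by simp
  qed
  moreover have "finite (level_tree p i)"
    using finite_fs_ntree[OF cond_at_fs_ntree[OF c i]] .
  ultimately show ?thesis
    unfolding Finite_inter_def forces_Finite_fm[OF p]
    by (intro densely_now exI[of _ "level_tree p i"]) (use le_trans in \<open>auto simp del: forces.simps(2)\<close>)
qed

text \<open>A sequence promised to the \<open>i\<close>-th tree lies in \<open>W \<T>\<close>, so it leaves \<open>T\<close> at some level. All other
  nodes can be prolonged outside \<open>T\<close>, as \<open>T\<close> is finitely splitting. At a level that is above all
  these exits the two trees are disjoint.\<close>

lemma forces_finite_inter_ground:
  assumes q: "q \<in> TT \<T>" and T: "T \<in> \<T>"
  shows "q \<Vdash> Finite_inter (S_name \<T> i) (check (TT \<T>) T)"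
proof (rule forces_densely[OF q], unfold dense_below_def, intro ballI impI)
  fix q' assume q': "q' \<in> TT \<T>"
  obtain F n p where p: "cond_at F n p (snd q')" "TT_le (p, snd q') q'" and i: "i \<in> F"
    by (rule extend_domain[OF q', of "{i}"]) auto
  define w where "w = snd q'"
  note c = p(1)[folded w_def]
  have tree: "fs_tree T"
    using adfs T by (simp add: adfs_def)
  have "\<exists>m0. \<forall>m\<ge>m0. \<forall>f\<in>{f. w f = Some i}. restr f m \<notin> T"
  proof (rule finite_uniform_threshold[OF finite_promised[OF c]])
    fix f assume "f \<in> {f. w f = Some i}"
    then have "f \<notin> branches T"
      using c T by (auto simp: cond_at_def W_def)
    then show "\<exists>k. \<forall>m\<ge>k. restr f m \<notin> T"
      using eventually_leaves_tree[OF tree] by blast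
  qed
  then obtain m0 where m0: "\<And>m f. m0 \<le> m \<Longrightarrow> w f = Some i \<Longrightarrow> restr f m \<notin> T"
    by auto
  define m where "m = max m0 (Suc n)"
  \<comment> \<open>One value \<open>k\<close> takes all of the finitely many nodes of the \<open>i\<close>-th tree out of \<open>T\<close> at once.\<close>
  have "finite {k. s @ [k] \<in> T}" for s
  proof (cases "s \<in> T")
    case True
    then have "finite {t. imm_succ s t \<and> t \<in> T}"
      using tree by (simp add: fs_tree_def)
    then have "finite ((\<lambda>k. s @ [k]) -` {t. imm_succ s t \<and> t \<in> T})"
      by (rule finite_vimageI) (simp add: inj_on_def)
    then show ?thesis
      by (rule rev_finite_subset) (auto simp: imm_succ_def)
  next
    case False
    then have "{k. s @ [k] \<in> T} = {}"
      using fs_tree_take[OF tree, of "s @ [k]" "length s" for k] by auto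
    then show ?thesis by simp
  qed
  then have "finite (\<Union>s\<in>level_tree p i. {k. s @ [k] \<in> T})"
    using finite_fs_ntree[OF cond_at_fs_ntree[OF c i]] by simp
  then obtain k where "k \<notin> (\<Union>s\<in>level_tree p i. {k. s @ [k] \<in> T})"
    using ex_new_if_finite[OF infinite_UNIV_nat] by blast
  then have k: "s @ [k] \<notin> T" if "s \<in> level_tree p i" for s
    using that by blast
  have "finite F" "n \<le> m"
    using c by (auto simp: cond_at_def tree_cond_def m_def)
  then obtain p' where c': "cond_at F m p' w" and "p \<subseteq>\<^sub>m p'"
    and level: "level_tree p' i = prolong n m {f. w f = Some i} k (level_tree p i)"
    using cond_at_prolong[OF c _ subset_refl, of m "\<lambda>_. k"] i by blast
  have "(p', w) \<Vdash> Finite_inter (S_name \<T> i) (check (TT \<T>) T)"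
  proof (rule forces_Finite_inter_S_name[OF c' i])
    fix r s assume r: "r \<in> TT \<T>" "r \<Vdash> SeqIn s (check (TT \<T>) T)" and len: "m \<le> length s"
    have "s \<in> T"
      using r by (simp add: forces_mem_check)
    then have inT: "take m s \<in> T" "take (Suc n) (take m s) \<in> T"
      using fs_tree_take[OF tree] by blast+
    show "take m s \<notin> level_tree p' i"
    proof
      assume "take m s \<in> level_tree p' i"
      then consider f where "w f = Some i" "take m s = restr f m"
        | "take n (take m s) \<in> level_tree p i"
          "take m s = take n (take m s) @ replicate (m - n) k"
        using prolong_top[of "take m s"] len unfolding level by (force simp: m_def)
      then show False
      proof cases
        case 1
        then show False
          using m0[of m f] inT by (simp add: m_def)
      next
        case 2
        have "m - n = Suc (m - Suc n)" "length (take n (take m s)) = n"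
          using len by (auto simp: m_def)
        then have "take (Suc n) (take n (take m s) @ replicate (m - n) k) = take n (take m s) @ [k]"
          by simp
        then show False
          using k 2 inT by metis
      qed
    qed
  qed
  moreover have "TT_le (p', w) q'"
    using p(2) \<open>p \<subseteq>\<^sub>m p'\<close> map_le_trans by (auto simp: TT_le_def w_def)
  ultimately show "\<exists>r\<in>TT \<T>. TT_le r q' \<and> r \<Vdash> Finite_inter (S_name \<T> i) (check (TT \<T>) T)"
    using c' TT_iff by blast
qed

text \<open>As \<open>w\<close> is a function, the branches promised to the \<open>i\<close>-th and to the \<open>j\<close>-th tree are different,
  hence separated at some level. The remaining nodes of the two trees are told apart
  by their entry at position \<open>n\<close>: it is \<open>K + i\<close> in the one, \<open>K + j\<close> in the other, and less than
  \<open>K\<close> on promised branches.\<close>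

lemma forces_finite_inter_generic:
  assumes q: "q \<in> TT \<T>" and "i \<noteq> j"
  shows "q \<Vdash> Finite_inter (S_name \<T> i) (S_name \<T> j)"
proof (rule forces_densely[OF q], unfold dense_below_def, intro ballI impI)
  fix q' assume q': "q' \<in> TT \<T>"
  obtain F n p where p: "cond_at F n p (snd q')" "TT_le (p, snd q') q'"
    and ij: "i \<in> F" "j \<in> F"
    by (rule extend_domain[OF q', of "{i, j}"]) auto
  define w where "w = snd q'"
  note c = p(1)[folded w_def]
  have dom: "finite (dom w)"
    using c by (simp add: cond_at_def)
  have "\<exists>m0. \<forall>m\<ge>m0. \<forall>x\<in>{f. w f = Some i} \<times> {f. w f = Some j}. restr (fst x) m \<noteq> restr (snd x) m"
    by (rule finite_uniform_threshold) (use finite_promised[OF c] restr_separates \<open>i \<noteq> j\<close> in force)+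
  then obtain m0 where m0:
    "\<And>m f g. m0 \<le> m \<Longrightarrow> w f = Some i \<Longrightarrow> w g = Some j \<Longrightarrow> restr f m \<noteq> restr g m"
    by auto
  define m where "m = max m0 (Suc n)"
  obtain K where K: "\<And>f. f \<in> dom w \<Longrightarrow> f n < K"
    using finite_nat_set_iff_bounded[of "(\<lambda>f. f n) ` dom w"] dom by auto
  have "finite F" "n \<le> m"
    using c by (auto simp: cond_at_def tree_cond_def m_def)
  then obtain p' where c': "cond_at F m p' w" and "p \<subseteq>\<^sub>m p'"
    and level: "\<forall>l\<in>F. level_tree p' l = prolong n m {f. w f = Some l} (K + l) (level_tree p l)"
    using cond_at_prolong[OF c _ subset_refl, of m "\<lambda>l. K + l"] by blast
  have top: "(\<exists>f. w f = Some l \<and> t = restr f m) \<or> t ! n = K + l"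
    if "t \<in> level_tree p' l" "length t = m" "l \<in> F" for t l
  proof -
    have "t ! n = K + l" if "t = take n t @ replicate (m - n) (K + l)"
    proof -
      have "(take n t @ replicate (m - n) (K + l)) ! n = K + l"
        using \<open>length t = m\<close> by (simp add: m_def nth_append min_def)
      then show ?thesis using that by simp
    qed
    then show ?thesis
      using prolong_top[of t n m] that level by (force simp: m_def)
  qed
  have below: "restr f m ! n < K" if "w f = Some l" for f l
    using K[of f] that by (auto simp: restr_def m_def)
  have "(p', w) \<Vdash> Finite_inter (S_name \<T> i) (S_name \<T> j)"
  proof (rule forces_Finite_inter_S_name[OF c' ij(1)])
    fix r s assume r: "r \<in> TT \<T>" "TT_le r (p', w)" "r \<Vdash> SeqIn s (S_name \<T> j)" and len: "m \<le> length s"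
    have j: "take m s \<in> level_tree p' j"
      using forced_in_S_name_decided[OF c' ij(2) r] .
    show "take m s \<notin> level_tree p' i"
    proof
      assume "take m s \<in> level_tree p' i"
      then have "(\<exists>f. w f = Some i \<and> take m s = restr f m) \<or> take m s ! n = K + i"
        using top ij len by simp
      moreover have "(\<exists>f. w f = Some j \<and> take m s = restr f m) \<or> take m s ! n = K + j"
        using top[OF j] ij len by simp
      moreover have "m0 \<le> m"
        by (simp add: m_def)
      ultimately show False
        using m0 below \<open>i \<noteq> j\<close> by (metis add_left_cancel not_add_less1)
    qed
  qed
  moreover have "TT_le (p', w) q'"
    using p(2) \<open>p \<subseteq>\<^sub>m p'\<close> map_le_trans by (auto simp: TT_le_def w_def)
  ultimately show "\<exists>r\<in>TT \<T>. TT_le r q' \<and> r \<Vdash> Finite_inter (S_name \<T> i) (S_name \<T> j)"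
    using c' TT_iff by blast
qed

text \<open>A new promise is compatible with \<open>p\<close> as soon as it concerns an index outside the finite set \<open>F\<close>.\<close>

lemma promise_branch:
  assumes "q \<in> TT \<T>" and "f \<in> W \<T>"
  shows "\<exists>r\<in>TT \<T>. TT_le r q \<and> (\<exists>i. snd r f = Some i)"
proof -
  obtain p w F n where q: "q = (p, w)" and c: "cond_at F n p w"
    using assms(1) TT_iff by (metis surj_pair)
  show ?thesis
  proof (cases "w f")
    case None
    have "finite F"
      using c by (simp add: cond_at_def tree_cond_def)
    then obtain i where i: "i \<notin> F"
      using ex_new_if_finite[OF infinite_UNIV_nat] by blast
    have "cond_at F n p (w(f \<mapsto> i))"
      using c i assms(2) by (auto simp: cond_at_def)
    moreover have "w \<subseteq>\<^sub>m w(f \<mapsto> i)"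
      using None by (auto simp: map_le_def)
    ultimately show ?thesis
      using q TT_iff by (intro bexI[of _ "(p, w(f \<mapsto> i))"]) (auto simp: TT_le_def)
  next
    case (Some i)
    then show ?thesis
      using assms(1) q le_refl by (intro bexI[of _ q]) auto
  qed
qed

lemma promise_kept:
  assumes q: "q \<in> TT \<T>" and f: "snd q f = Some i"
  shows "q \<Vdash> SeqIn (restr f n) (S_name \<T> i)"
  unfolding forces_S_name[OF q] dense_below_def
proof (intro ballI impI)
  fix r assume r: "r \<in> TT \<T>" "TT_le r q"
  obtain F m p where p: "cond_at F m p (snd r)" "(p, snd r) \<in> TT \<T>" "TT_le (p, snd r) r"
    and "i \<in> F" "n \<le> m"
    by (rule extend_domain[OF r(1), of "{i}" n]) auto
  have "snd r f = Some i"
    using r(2) f unfolding TT_le_def by (metis domI map_le_def)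
  then have "restr f m \<in> level_tree p i"
    using p(1) \<open>i \<in> F\<close> unfolding cond_at_def by blast
  then have "p (i, restr f n) = Some True"
    using cond_prefix[OF p(2), of i "restr f m" "restr f n"] \<open>n \<le> m\<close> take_restr[of n f m] take_is_prefix[of n "restr f m"]
    by (simp add: level_tree_def min_def)
  then show "\<exists>r'\<in>TT \<T>. TT_le r' r \<and> fst r' (i, restr f n) = Some True"
    using p by (intro bexI[of _ "(p, snd r)"]) auto
qed

text \<open>A positive tree \<open>T\<close> has, in the ground model, a branch \<open>f\<close>, and \<open>f\<close> lies in \<open>W \<T>\<close>. Once \<open>f\<close> is
  promised to the \<open>i\<close>-th generic tree, all the initial segments of \<open>f\<close> are common nodes.\<close>

lemma forces_hits_positive:
  assumes q: "q \<in> TT \<T>" and T: "T \<in> I_plus \<T>"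
  shows "densely q (\<lambda>r. \<exists>i. r \<Vdash> Neg (Finite_inter (S_name \<T> i) (check (TT \<T>) T)))"
proof -
  obtain f where f: "f \<in> branches T" "f \<in> W \<T>"
    using T fs_tree_has_branch unfolding I_plus_def by blast
  have "\<exists>i. r \<Vdash> Neg (Finite_inter (S_name \<T> i) (check (TT \<T>) T))"
    if r: "r \<in> TT \<T>" "snd r f = Some i" for r i
  proof (rule exI, rule forces_infinite_inter)
    show "infinite (range (restr f))"
      using finite_imageD[OF _ inj_restr] infinite_UNIV_nat by blast
    show "r \<Vdash> SeqIn s (S_name \<T> i)" if "s \<in> range (restr f)" for s
      using that promise_kept[OF r] by blast
    show "r \<Vdash> SeqIn s (check (TT \<T>) T)" if "s \<in> range (restr f)" for s
      using that f(1) r(1) by (auto simp: forces_mem_check branches_def)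
  qed
  then show ?thesis
    unfolding dense_below_def using promise_branch[OF _ f(2)] by meson
qed

section \<open>Diagonalization\<close>

lemma forces_mem_S_family_name:
  "q \<Vdash> SetIn \<sigma> (S_family_name \<T>) \<longleftrightarrow> densely q (\<lambda>r. \<exists>i. forces_eq (TT \<T>) TT_le \<sigma> (S_name \<T> i) r)"
  by (simp add: S_family_name_def forces_mem_fam_check)

lemma forces_mem_check_fam:
  "q \<Vdash> SetIn \<sigma> (check_fam (TT \<T>) N) \<longleftrightarrow>
    densely q (\<lambda>r. \<exists>T\<in>N. forces_eq (TT \<T>) TT_le \<sigma> (check (TT \<T>) T) r)"
  by (simp add: check_fam_def forces_mem_fam_check)

text \<open>Names of the elements of the union of \<open>\<T>\<close> and the generic family. Densely, every name of an
  element is equal to one of these, and distinct ones are forced to be almost disjoint.\<close>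

definition family_names :: "(nat list, cond) name set" where
  "family_names = check (TT \<T>) ` \<T> \<union> range (S_name \<T>)"

lemma family_names_cases:
  assumes "q \<Vdash> SetIn \<sigma> (check_fam (TT \<T>) \<T> \<union> S_family_name \<T>)"
  shows "densely q (\<lambda>r. \<exists>\<upsilon>\<in>family_names. forces_eq (TT \<T>) TT_le \<sigma> \<upsilon> r)"
proof (rule densely_bind[OF forces_mem_fam_Un])
  show "forces_mem_fam (TT \<T>) TT_le \<sigma> (check_fam (TT \<T>) \<T> \<union> S_family_name \<T>) q"
    using assms by simp
next
  fix r
  assume "forces_mem_fam (TT \<T>) TT_le \<sigma> (check_fam (TT \<T>) \<T>) r \<or>
    forces_mem_fam (TT \<T>) TT_le \<sigma> (S_family_name \<T>) r"
  then show "densely r (\<lambda>r. \<exists>\<upsilon>\<in>family_names. forces_eq (TT \<T>) TT_le \<sigma> \<upsilon> r)"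
    using forces_mem_check_fam[of \<sigma> \<T> r] forces_mem_S_family_name[of \<sigma> r]
    by (auto simp: family_names_def elim!: densely_mono)
qed

lemma family_names_FsTree:
  assumes "q \<in> TT \<T>" and "\<upsilon> \<in> family_names"
  shows "q \<Vdash> FsTree_fm \<upsilon>"
  using assms adfs forces_FsTree_check forces_FsTree_S_name unfolding family_names_def adfs_def by blast

lemma family_names_Finite_inter:
  assumes q: "q \<in> TT \<T>" and "\<upsilon> \<in> family_names" "\<upsilon>' \<in> family_names" and "\<upsilon> \<noteq> \<upsilon>'"
  shows "q \<Vdash> Finite_inter \<upsilon> \<upsilon>'"
proof -
  have "finite (S \<inter> T)" if "S \<in> \<T>" "T \<in> \<T>" "S \<noteq> T" for S T
    using that adfs by (simp add: adfs_def)
  then show ?thesis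
    using assms(2-4) forces_Finite_inter_check[OF q] forces_finite_inter_ground[OF q]
      forces_finite_inter_generic[OF q] Finite_inter_commute[OF q]
    unfolding family_names_def by (elim UnE imageE) metis+
qed

lemma forces_Adfs:
  assumes "q \<in> TT \<T>"
  shows "q \<Vdash> Adfs_fm (check_fam (TT \<T>) \<T> \<union> S_family_name \<T>)" (is "q \<Vdash> Adfs_fm ?\<Sigma>")
proof -
  have tree: "r \<Vdash> FsTree_fm \<sigma>" if r: "r \<in> TT \<T>" "r \<Vdash> SetIn \<sigma> ?\<Sigma>" for r \<sigma>
    by (rule forces_densely[OF r(1) densely_mono[OF family_names_cases[OF r(2)]]])
      (use FsTree_fm_cong family_names_FsTree in blast)
  have inter: "r \<Vdash> Finite_inter \<sigma> \<tau>"
    if r: "r \<in> TT \<T>" "r \<Vdash> SetIn \<sigma> ?\<Sigma>" "r \<Vdash> SetIn \<tau> ?\<Sigma>" "r \<Vdash> Neg (EqSet \<sigma> \<tau>)" for r \<sigma> \<tau>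
  proof -
    have "densely r (\<lambda>r'. \<exists>\<upsilon>\<in>family_names. \<exists>\<upsilon>'\<in>family_names.
        forces_eq (TT \<T>) TT_le \<sigma> \<upsilon> r' \<and> forces_eq (TT \<T>) TT_le \<tau> \<upsilon>' r')"
    proof (rule densely_bind[OF family_names_cases[OF r(2)]], elim bexE)
      fix r' \<upsilon> assume r': "TT_le r' r" and \<upsilon>: "\<upsilon> \<in> family_names" "forces_eq (TT \<T>) TT_le \<sigma> \<upsilon> r'"
      show "densely r' (\<lambda>r'. \<exists>\<upsilon>\<in>family_names. \<exists>\<upsilon>'\<in>family_names.
          forces_eq (TT \<T>) TT_le \<sigma> \<upsilon> r' \<and> forces_eq (TT \<T>) TT_le \<tau> \<upsilon>' r')"
        by (rule densely_mono[OF densely_antimono[OF family_names_cases[OF r(3)] r']])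
          (use \<upsilon> forces_eq_mono in blast)
    qed
    then show ?thesis
    proof (rule forces_densely[OF r(1) densely_mono], elim bexE conjE)
      fix r' \<upsilon> \<upsilon>'
      assume r': "r' \<in> TT \<T>" "TT_le r' r" and mem: "\<upsilon> \<in> family_names" "\<upsilon>' \<in> family_names"
        and eq: "forces_eq (TT \<T>) TT_le \<sigma> \<upsilon> r'" "forces_eq (TT \<T>) TT_le \<tau> \<upsilon>' r'"
      \<comment> \<open>If both were equal to the same name, \<open>\<sigma>\<close> and \<open>\<tau>\<close> would be forced to coincide.\<close>
      have "\<not> r' \<Vdash> EqSet \<sigma> \<tau>"
        using r(4) r' by simp
      then have "\<upsilon> \<noteq> \<upsilon>'"
        using forces_EqSet[OF r'(1)] eq by blast
      then show "r' \<Vdash> Finite_inter \<sigma> \<tau>"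
        using Finite_inter_cong[OF r'(1) eq] family_names_Finite_inter[OF r'(1) mem] by blast
    qed
  qed
  show ?thesis
    using assms tree inter by (simp add: Adfs_fm_def forces_Imp)
qed

lemma forces_Diagonalizes:
  assumes q: "q \<in> TT \<T>"
  shows "q \<Vdash> Diagonalizes_fm (TT \<T>) \<T> (S_family_name \<T>)"
proof -
  have "r \<Vdash> ExSet (\<lambda>\<sigma>. And (SetIn \<sigma> (S_family_name \<T>)) (Neg (Finite_inter \<sigma> \<tau>)))"
    if r: "r \<in> TT \<T>" "r \<Vdash> SetIn \<tau> (check_fam (TT \<T>) (I_plus \<T>))" for r \<tau>
    unfolding forces_ExSet
  proof (rule densely_bind[OF r(2)[unfolded forces_mem_check_fam]], elim bexE)
    fix r' T
    assume r': "r' \<in> TT \<T>" and T: "T \<in> I_plus \<T>" and eq: "forces_eq (TT \<T>) TT_le \<tau> (check (TT \<T>) T) r'"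
    show "densely r' (\<lambda>p. \<exists>\<sigma>. p \<Vdash> And (SetIn \<sigma> (S_family_name \<T>)) (Neg (Finite_inter \<sigma> \<tau>)))"
    proof (rule densely_mono[OF forces_hits_positive[OF r' T]], elim exE)
      fix s i
      assume s: "s \<in> TT \<T>" "TT_le s r'"
        and inf: "s \<Vdash> Neg (Finite_inter (S_name \<T> i) (check (TT \<T>) T))"
      have "u \<Vdash> Finite_inter (S_name \<T> i) \<tau> \<longleftrightarrow> u \<Vdash> Finite_inter (S_name \<T> i) (check (TT \<T>) T)"
        if "u \<in> TT \<T>" "TT_le u s" for u
        using Finite_inter_cong[OF that(1) forces_eq_refl] forces_eq_mono[OF eq] le_trans that(2) s(2)
        by blast
      then have "s \<Vdash> Neg (Finite_inter (S_name \<T> i) \<tau>)"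
        using inf by simp
      moreover have "s \<Vdash> SetIn (S_name \<T> i) (S_family_name \<T>)"
        unfolding forces_mem_S_family_name using forces_eq_refl by (intro densely_now) blast
      ultimately show "\<exists>\<sigma>. s \<Vdash> And (SetIn \<sigma> (S_family_name \<T>)) (Neg (Finite_inter \<sigma> \<tau>))"
        by auto
    qed
  qed
  then show ?thesis
    unfolding Diagonalizes_fm_def using forces_Adfs[OF q] q by (simp add: forces_Imp)
qed

end

theorem proposition3p12:
  fixes \<T> :: "nat list set set"
  assumes "adfs \<T>"
  shows "holds_in_extension (TT \<T>) TT_le (Diagonalizes_fm (TT \<T>) \<T> (S_family_name \<T>))"
proof -
  interpret tree_forcing \<T>
    using assms by unfold_locales
  show ?thesis
    unfolding holds_in_extension_def using forces_Diagonalizes by blast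
qed

end
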